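(* Let $b$ be a natural number and let $c,d\in\mathbb{Z}$ with $\gcd(c,b)=\gcd(d,b)=1$ and $c\not\equiv d \pmod b$. Suppose that $(c-d)(cd-1)\equiv 0 \pmod b$. Let $t>0$ be an integer such that $t\equiv c-d \pmod b$. Then $S(c,b)=S(d,b)$ if, and only if, $$S(1+ct,\,bt)=\frac{2+t^2}{bt}-3.$$
   Context: For a natural number $b$ (positive integer) and an integer $c$ with $\gcd(c,b)=1$, the classical Dedekind sum is $s(c,b)=\sum_{k=1}^{b}((k/b))((ck/b))$, where $((x))=x-\lfloor x\rfloor-1/2$ if $x\in\mathbb{R}\setminus\mathbb{Z}$ and $((x))=0$ if $x\in\mathbb{Z}$. The normalized Dedekind sum is $S(c,b)=12\,s(c,b)$. *)

theory Defs
  imports Complex_Main "HOL-Number_Theory.Cong"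
begin

definition sawtooth :: "real \<Rightarrow> real" where
  "sawtooth x = (if x \<in> \<int> then 0 else x - of_int \<lfloor>x\<rfloor> - 1 / 2)"

text \<open>The modulus is an integer, so that products of a modulus with an integer need no
  conversion; only positive moduli are meaningful (the sum is empty otherwise).\<close>

definition dedekind_sum :: "int \<Rightarrow> int \<Rightarrow> real" where
  "dedekind_sum c b =
     (\<Sum>k = 1..b. sawtooth (of_int k / of_int b) * sawtooth (of_int (c * k) / of_int b))"

definition normalized_dedekind_sum :: "int \<Rightarrow> int \<Rightarrow> real" where
  "normalized_dedekind_sum c b = 12 * dedekind_sum c b"

end

theory Submission
  imports Defs
begin

text \<open>Let \<open>e\<close> be an inverse of \<open>c\<close> modulo \<open>b\<close>. The hypothesis on \<open>(c - d) (c d - 1)\<close> says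
  exactly that \<open>e + t\<close> is an inverse of \<open>d\<close>. As \<open>S(x, b)\<close> does not change when \<open>x\<close> is replaced by
  its inverse, \<open>S(d, b) - S(c, b) = S(e + t, b) - S(e, b)\<close>, and the three-term relation evaluates
  this difference as \<open>(2 + t\<^sup>2) / (b t) - 3 - S(1 + c t, b t)\<close>. The three-term relation follows from
  the reciprocity law by the Euclidean algorithm, and the reciprocity law from lattice point counting.\<close>

section \<open>Sawtooth values at rational arguments\<close>

lemma sawtooth_of_int_divide:
  fixes n b :: int
  assumes "b > 0"
  shows "sawtooth (of_int n / of_int b) = (if b dvd n then 0 else of_int (n mod b) / of_int b - 1 / 2)"
proof -
  have int_iff: "(of_int n / of_int b :: real) \<in> \<int> \<longleftrightarrow> b dvd n"
  proof
    assume "(of_int n / of_int b :: real) \<in> \<int>"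
    then obtain z where "(of_int n / of_int b :: real) = of_int z" by (elim Ints_cases)
    with assms have "(of_int n :: real) = of_int (z * b)" by (simp add: field_simps)
    then have "n = z * b" by (simp only: of_int_eq_iff)
    then show "b dvd n" by simp
  next
    assume "b dvd n"
    with assms show "(of_int n / of_int b :: real) \<in> \<int>" by (auto elim!: dvdE)
  qed
  have "real_of_int n = of_int b * of_int (n div b) + of_int (n mod b)"
    by (metis mult_div_mod_eq of_int_add of_int_mult)
  then have "of_int n / of_int b - real_of_int (n div b) = of_int (n mod b) / of_int b"
    using assms by (simp add: field_simps)
  then show ?thesis
    by (simp add: sawtooth_def int_iff floor_divide_of_int_eq)
qed

lemma sawtooth_cong:
  fixes m n b :: int
  assumes "b > 0" "[m = n] (mod b)"
  shows "sawtooth (of_int m / of_int b) = sawtooth (of_int n / of_int b)"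
  using assms by (simp add: sawtooth_of_int_divide cong_def dvd_eq_mod_eq_0)

lemma sawtooth_minus: "sawtooth (- x) = - sawtooth x"
proof (cases "x \<in> \<int>")
  case False
  \<comment> \<open>Off the integers the ceiling is the floor plus one, and this extra 1 turns
    \<open>- 1 / 2\<close> into \<open>1 / 2\<close>.\<close>
  then have "x \<noteq> of_int \<lfloor>x\<rfloor>" by (metis Ints_of_int)
  with False show ?thesis by (simp add: sawtooth_def floor_minus ceiling_altdef)
qed (simp add: sawtooth_def)

section \<open>Dedekind sums over residues and their symmetries\<close>

lemma dedekind_sum_altdef:
  assumes "b > 0"
  shows "dedekind_sum c b =
    (\<Sum>k\<in>{0..<b}. sawtooth (of_int k / of_int b) * sawtooth (of_int (c * k) / of_int b))"
proof -
  let ?f = "\<lambda>k. sawtooth (of_int k / of_int b) * sawtooth (of_int (c * k) / of_int b)"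
  \<comment> \<open>Index \<open>b\<close> is exchanged for index 0, both with vanishing terms, so
    that the range is the set of values of \<open>mod b\<close> and can be permuted.\<close>
  have "{1..b} = insert b {1..<b}" "{0..<b} = insert 0 {1..<b}" using assms by auto
  moreover have "?f b = 0" "?f 0 = 0" using assms by (simp_all add: sawtooth_def)
  ultimately show ?thesis unfolding dedekind_sum_def by simp
qed

lemma bij_betw_mult_mod:
  fixes h k :: int
  assumes "k > 0" "coprime h k"
  shows "bij_betw (\<lambda>m. h * m mod k) {0..<k} {0..<k}"
proof -
  have inj: "inj_on (\<lambda>m. h * m mod k) {0..<k}"
  proof (rule inj_onI)
    fix x y assume xy: "x \<in> {0..<k}" "y \<in> {0..<k}" "h * x mod k = h * y mod k"
    then have "[x = y] (mod k)"
      using assms cong_mult_lcancel unfolding cong_def by blast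
    with xy show "x = y" by (simp add: cong_def)
  qed
  moreover have "(\<lambda>m. h * m mod k) ` {0..<k} \<subseteq> {0..<k}" using assms by auto
  ultimately show ?thesis
    by (simp add: bij_betw_def endo_inj_surj)
qed

lemma sum_mult_mod:
  fixes h k :: int
  assumes "k > 0" "coprime h k"
  shows "(\<Sum>m\<in>{0..<k}. f (h * m mod k)) = (\<Sum>m\<in>{0..<k}. f m)"
  using sum.reindex_bij_betw[OF bij_betw_mult_mod[OF assms]] .

lemma normalized_dedekind_sum_cong:
  assumes "b > 0" "[c = d] (mod b)"
  shows "normalized_dedekind_sum c b = normalized_dedekind_sum d b"
proof -
  have "sawtooth (of_int (c * k) / of_int b) = sawtooth (of_int (d * k) / of_int b)" for k
    using assms by (intro sawtooth_cong cong_mult cong_refl)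
  then show ?thesis by (simp add: normalized_dedekind_sum_def dedekind_sum_def)
qed

lemma normalized_dedekind_sum_minus:
  "normalized_dedekind_sum (- c) b = - normalized_dedekind_sum c b"
  by (simp add: normalized_dedekind_sum_def dedekind_sum_def sawtooth_minus sum_negf)

text \<open>Substituting \<open>d * k mod b\<close> for \<open>k\<close> turns the second factor
  into the sawtooth of \<open>k / b\<close> and the first into that of \<open>d * k / b\<close>: the
  two factors trade places.\<close>

lemma normalized_dedekind_sum_inverse:
  assumes b: "b > 0" and cd: "[c * d = 1] (mod b)"
  shows "normalized_dedekind_sum c b = normalized_dedekind_sum d b"
proof -
  let ?s = "\<lambda>k. sawtooth (of_int k / of_int b)"
  have "coprime d b" using cd by (metis coprime_iff_invertible_int mult.commute)
  have s_mod: "?s (k mod b) = ?s k" for k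
    by (rule sawtooth_cong[OF b]) simp
  have s_cdk: "?s (c * (d * k mod b)) = ?s k" for k
  proof (rule sawtooth_cong[OF b])
    have "[c * (d * k mod b) = c * (d * k)] (mod b)" by (simp add: cong_def mod_mult_right_eq)
    also have "c * (d * k) = c * d * k" by simp
    also have "[c * d * k = 1 * k] (mod b)" using cd by (intro cong_mult cong_refl)
    finally show "[c * (d * k mod b) = k] (mod b)" by simp
  qed
  have "dedekind_sum c b = (\<Sum>k\<in>{0..<b}. ?s (d * k mod b) * ?s (c * (d * k mod b)))"
    unfolding dedekind_sum_altdef[OF b]
    by (rule sum_mult_mod[OF b \<open>coprime d b\<close>, symmetric])
  also have "\<dots> = (\<Sum>k\<in>{0..<b}. ?s k * ?s (d * k))"
    by (simp only: s_cdk s_mod mult.commute[of "?s (d * _)"])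
  also have "\<dots> = dedekind_sum d b" using dedekind_sum_altdef[OF b] by simp
  finally show ?thesis by (simp add: normalized_dedekind_sum_def)
qed

section \<open>Power sums and sums of floors\<close>

lemma sum_int_lessThan:
  fixes n :: int
  assumes "n \<ge> 0"
  shows "2 * (\<Sum>m\<in>{0..<n}. m) = n * (n - 1)"
  using assms
proof (induction n rule: int_ge_induct)
  case (step n)
  then have "{0..<n + 1} = insert n {0..<n}" by auto
  with step show ?case by (simp add: algebra_simps)
qed simp

lemma sum_int_squares_lessThan:
  fixes n :: int
  assumes "n \<ge> 0"
  shows "6 * (\<Sum>m\<in>{0..<n}. m\<^sup>2) = n * (n - 1) * (2 * n - 1)"
  using assms
proof (induction n rule: int_ge_induct)
  case (step n)
  then have "{0..<n + 1} = insert n {0..<n}" by auto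
  with step show ?case by (simp add: algebra_simps power2_eq_square)
qed simp

text \<open>The remainders \<open>h * m mod k\<close> permute the residues, so summing
  \<open>h * m mod k = h * m - k * (h * m div k)\<close> over \<open>m\<close> determines the sum of
  the quotients.\<close>

lemma sum_floor:
  fixes h k :: int
  assumes "k > 0" "coprime h k"
  shows "2 * (\<Sum>m\<in>{0..<k}. h * m div k) = (h - 1) * (k - 1)"
proof -
  have "(\<Sum>m\<in>{0..<k}. m) = (\<Sum>m\<in>{0..<k}. h * m mod k)"
    by (rule sum_mult_mod[OF assms, symmetric])
  also have "\<dots> = (\<Sum>m\<in>{0..<k}. h * m - k * (h * m div k))"
    by (intro sum.cong refl) (simp add: minus_mult_div_eq_mod)
  also have "\<dots> = h * (\<Sum>m\<in>{0..<k}. m) - k * (\<Sum>m\<in>{0..<k}. h * m div k)"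
    by (simp add: sum_subtractf sum_distrib_left)
  finally have "k * (2 * (\<Sum>m\<in>{0..<k}. h * m div k)) = (h - 1) * (2 * (\<Sum>m\<in>{0..<k}. m))"
    by (simp add: algebra_simps)
  also have "\<dots> = k * ((h - 1) * (k - 1))"
    using assms by (simp add: sum_int_lessThan)
  finally show ?thesis using assms by simp
qed

text \<open>The same permutation, applied to the squares of the remainders. It links the mixed sum
  of \<open>m * (h * m div k)\<close>, the essential part of a Dedekind sum, to the sum of squared
  quotients.\<close>

lemma sum_floor_squares:
  fixes h k :: int
  assumes "k > 0" "coprime h k"
  shows "(\<Sum>m\<in>{0..<k}. m\<^sup>2) = h\<^sup>2 * (\<Sum>m\<in>{0..<k}. m\<^sup>2)
    - 2 * h * k * (\<Sum>m\<in>{0..<k}. m * (h * m div k)) + k\<^sup>2 * (\<Sum>m\<in>{0..<k}. (h * m div k)\<^sup>2)"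
proof -
  have "(\<Sum>m\<in>{0..<k}. m\<^sup>2) = (\<Sum>m\<in>{0..<k}. (h * m mod k)\<^sup>2)"
    by (rule sum_mult_mod[OF assms, symmetric])
  also have "\<dots> = (\<Sum>m\<in>{0..<k}. h\<^sup>2 * m\<^sup>2 - 2 * h * k * (m * (h * m div k)) + k\<^sup>2 * (h * m div k)\<^sup>2)"
  proof (intro sum.cong refl)
    fix m
    have "h * m mod k = h * m - k * (h * m div k)" by (simp add: minus_mult_div_eq_mod)
    then show "(h * m mod k)\<^sup>2 = h\<^sup>2 * m\<^sup>2 - 2 * h * k * (m * (h * m div k)) + k\<^sup>2 * (h * m div k)\<^sup>2"
      by algebra
  qed
  also have "\<dots> = h\<^sup>2 * (\<Sum>m\<in>{0..<k}. m\<^sup>2)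
    - 2 * h * k * (\<Sum>m\<in>{0..<k}. m * (h * m div k)) + k\<^sup>2 * (\<Sum>m\<in>{0..<k}. (h * m div k)\<^sup>2)"
    by (simp only: sum.distrib sum_subtractf sum_distrib_left)
  finally show ?thesis .
qed

section \<open>Lattice point counting and the reciprocity law\<close>

lemma div_int_less_iff:
  fixes k n v :: int
  assumes "k > 0"
  shows "n div k < v \<longleftrightarrow> n < v * k"
proof -
  have "n div k < v \<longleftrightarrow> real_of_int n / of_int k < of_int v"
    by (simp only: floor_less_iff flip: floor_divide_of_int_eq[where ?'a = real])
  also have "\<dots> \<longleftrightarrow> real_of_int n < of_int (v * k)"
    using assms by (simp add: pos_divide_less_eq)
  finally show ?thesis by (simp only: of_int_less_iff)
qed

text \<open>Both sides count the lattice points \<open>(m, v)\<close> in the triangle \<open>v k \<le> h m\<close>, each with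
  weight \<open>2 v\<close>, by columns and by rows. Coprimality keeps the hypotenuse free of points.\<close>

lemma sum_floor_double_count:
  fixes h k :: int
  assumes h: "h > 0" and k: "k > 0" and "coprime h k"
  shows "(\<Sum>m\<in>{0..<k}. (h * m div k)\<^sup>2) + (\<Sum>m\<in>{0..<k}. h * m div k) =
    2 * (k - 1) * (\<Sum>v\<in>{0..<h}. v) - 2 * (\<Sum>v\<in>{0..<h}. v * (k * v div h))"
proof -
  have column: "(h * m div k)\<^sup>2 + h * m div k = (\<Sum>v\<in>{0..<h}. if v * k \<le> h * m then 2 * v else 0)"
    if "m \<in> {0..<k}" for m
  proof -
    have le_iff: "v * k \<le> h * m \<longleftrightarrow> v \<le> h * m div k" for v
      using div_int_less_iff[OF k, of "h * m" v] by linarith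
    have nonneg: "h * m div k \<ge> 0" using that h k by (simp add: pos_imp_zdiv_nonneg_iff)
    \<comment> \<open>The column ends below height \<open>h\<close>, so the range of
      \<open>v\<close> cuts nothing off.\<close>
    have "h * m < h * k" using that h by simp
    then have "h * m div k < h" using k by (simp add: div_int_less_iff)
    then have "{v \<in> {0..<h}. v * k \<le> h * m} = {0..<h * m div k + 1}"
      by (auto simp: le_iff)
    then have "(\<Sum>v\<in>{0..<h}. if v * k \<le> h * m then 2 * v else 0) = 2 * (\<Sum>v\<in>{0..<h * m div k + 1}. v)"
      by (simp only: sum.inter_filter[symmetric] finite_atLeastLessThan_int sum_distrib_left)
    also have "\<dots> = (h * m div k + 1) * (h * m div k)"
      using nonneg sum_int_lessThan[of "h * m div k + 1"] by simp
    also have "\<dots> = (h * m div k)\<^sup>2 + h * m div k"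
      by (simp only: power2_eq_square distrib_right mult_1_left)
    finally show ?thesis by (rule sym)
  qed
  have row: "(\<Sum>m\<in>{0..<k}. if v * k \<le> h * m then 2 * v else 0) = 2 * (k - 1) * v - 2 * (v * (k * v div h))"
    if "v \<in> {0..<h}" for v
  \<comment> \<open>The row \<open>v = 0\<close> is separate because the origin does lie on the line
    \<open>v * k = h * m\<close>; its weight is 0.\<close>
  proof (cases "v = 0")
    case False
    with that have v: "0 < v" "v < h" by auto
    have neq: "v * k \<noteq> h * m" for m
    proof
      assume "v * k = h * m"
      then have "h dvd v * k" by simp
      then have "h dvd v" using \<open>coprime h k\<close> by (simp only: coprime_dvd_mult_left_iff)
      with v show False by (simp add: zdvd_not_zless)
    qed
    define q where "q = k * v div h"
    \<comment> \<open>By \<open>neq\<close> the weak inequality is strict, so the row starts at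
      \<open>q + 1\<close>.\<close>
    have iff: "v * k \<le> h * m \<longleftrightarrow> q < m" for m
      using div_int_less_iff[OF h, of "k * v" m] neq[of m] unfolding q_def
      by (metis mult.commute order_le_less)
    have "q \<ge> 0" using v h k by (simp add: q_def pos_imp_zdiv_nonneg_iff)
    then have filter: "{m \<in> {0..<k}. v * k \<le> h * m} = {q + 1..<k}" by (auto simp: iff)
    have "q < k" using v h k by (simp add: q_def div_int_less_iff)
    have "(\<Sum>m\<in>{0..<k}. if v * k \<le> h * m then 2 * v else 0) = (\<Sum>m\<in>{q + 1..<k}. 2 * v)"
      by (simp only: sum.inter_filter[symmetric] finite_atLeastLessThan_int filter)
    also have "\<dots> = (k - (q + 1)) * (2 * v)" using \<open>q < k\<close> by simp
    also have "\<dots> = 2 * (k - 1) * v - 2 * (v * q)" by (simp add: algebra_simps)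
    finally show ?thesis by (simp only: q_def)
  next
    case True
    show ?thesis unfolding True by (simp cong: if_cong)
  qed
  have "(\<Sum>m\<in>{0..<k}. (h * m div k)\<^sup>2) + (\<Sum>m\<in>{0..<k}. h * m div k) =
    (\<Sum>m\<in>{0..<k}. (h * m div k)\<^sup>2 + h * m div k)"
    by (rule sum.distrib[symmetric])
  also have "\<dots> = (\<Sum>m\<in>{0..<k}. \<Sum>v\<in>{0..<h}. if v * k \<le> h * m then 2 * v else 0)"
    by (intro sum.cong refl column)
  also have "\<dots> = (\<Sum>v\<in>{0..<h}. 2 * (k - 1) * v - 2 * (v * (k * v div h)))"
    by (subst sum.swap) (intro sum.cong refl row)
  finally show ?thesis by (simp only: sum_subtractf sum_distrib_left)
qed

text \<open>The values of the sawtooth at \<open>h * m / k\<close> sum to 0, so the first factor may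
  be replaced by \<open>m / k\<close>. Writing the remainder as
  \<open>h * m - k * (h * m div k)\<close> then leaves one sum without an explicit value, that of
  \<open>m * (h * m div k)\<close>.\<close>

lemma normalized_dedekind_sum_floor:
  fixes h k :: int
  assumes k: "k > 0" and hk: "coprime h k"
  shows "normalized_dedekind_sum h k * of_int k =
    2 * of_int h * (of_int k - 1) * (2 * of_int k - 1)
    - 12 * of_int (\<Sum>m\<in>{0..<k}. m * (h * m div k)) - 3 * of_int k * (of_int k - 1)"
proof -
  let ?s = "\<lambda>m. sawtooth (of_int m / of_int k)"
  have s_mod: "?s (m mod k) = ?s m" for m
    by (rule sawtooth_cong[OF k]) simp
  have s1: "2 * real_of_int (\<Sum>m\<in>{0..<k}. m) = of_int k * (of_int k - 1)"
    using arg_cong[OF sum_int_lessThan[of k], of real_of_int] k by simp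
  have s2: "6 * real_of_int (\<Sum>m\<in>{0..<k}. m\<^sup>2) = of_int k * (of_int k - 1) * (2 * of_int k - 1)"
    using arg_cong[OF sum_int_squares_lessThan[of k], of real_of_int] k by simp
  have "(\<Sum>m\<in>{0..<k}. ?s (h * m)) = (\<Sum>m\<in>{0..<k}. ?s (h * m mod k))"
    by (simp only: s_mod)
  also have "\<dots> = (\<Sum>m\<in>{0..<k}. ?s m)" by (rule sum_mult_mod[OF k hk])
  \<comment> \<open>The correction at \<open>m = 0\<close> reflects the value 0 of the sawtooth at
    integers, where the linear formula gives \<open>- 1 / 2\<close>.\<close>
  also have "\<dots> = (\<Sum>m\<in>{0..<k}. of_int m / of_int k - 1 / 2 + (if m = 0 then 1 / 2 else 0))"
    by (intro sum.cong refl) (auto simp: sawtooth_of_int_divide[OF k] zdvd_not_zless)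
  also have "\<dots> = of_int (\<Sum>m\<in>{0..<k}. m) / of_int k - of_int k / 2 + 1 / 2"
    using k by (simp add: sum.distrib sum_subtractf sum_divide_distrib)
  also have "\<dots> = 0" using s1 k by (simp add: field_simps)
  finally have zero: "(\<Sum>m\<in>{0..<k}. ?s (h * m)) = 0" .
  have "dedekind_sum h k = (\<Sum>m\<in>{0..<k}. of_int m / of_int k * ?s (h * m) - ?s (h * m) / 2)"
    unfolding dedekind_sum_altdef[OF k]
  proof (intro sum.cong refl)
    fix m assume "m \<in> {0..<k}"
    then show "?s m * ?s (h * m) = of_int m / of_int k * ?s (h * m) - ?s (h * m) / 2"
      by (cases "m = 0") (simp_all add: sawtooth_def[of 0] sawtooth_of_int_divide[OF k] zdvd_not_zless algebra_simps)
  qed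
  also have "\<dots> = (\<Sum>m\<in>{0..<k}. of_int m / of_int k * ?s (h * m))"
    using zero by (simp add: sum_subtractf sum_divide_distrib[symmetric])
  also have "\<dots> = (\<Sum>m\<in>{0..<k}. of_int h / (of_int k)\<^sup>2 * of_int (m\<^sup>2)
      - of_int (m * (h * m div k)) / of_int k - of_int m / (2 * of_int k))"
  proof (intro sum.cong refl)
    fix m assume m: "m \<in> {0..<k}"
    show "of_int m / of_int k * ?s (h * m) = of_int h / (of_int k)\<^sup>2 * of_int (m\<^sup>2)
      - of_int (m * (h * m div k)) / of_int k - of_int m / (2 * of_int k)"
    proof (cases "m = 0")
      case False
      have "\<not> k dvd h * m"
        using m False hk by (auto simp: coprime_commute coprime_dvd_mult_right_iff zdvd_not_zless)
      moreover have "real_of_int (h * m mod k) = of_int h * of_int m - of_int k * of_int (h * m div k)"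
        by (simp flip: minus_mult_div_eq_mod)
      ultimately have s_hm: "?s (h * m) =
          (of_int h * of_int m - of_int k * of_int (h * m div k)) / of_int k - 1 / 2"
        using sawtooth_of_int_divide[OF k, of "h * m"] by simp
      show ?thesis
        unfolding s_hm using k by (simp add: field_simps power2_eq_square)
    qed simp
  qed
  also have "\<dots> = of_int h / (of_int k)\<^sup>2 * of_int (\<Sum>m\<in>{0..<k}. m\<^sup>2)
      - of_int (\<Sum>m\<in>{0..<k}. m * (h * m div k)) / of_int k - of_int (\<Sum>m\<in>{0..<k}. m) / (2 * of_int k)"
    by (simp only: sum_subtractf sum_distrib_left sum_divide_distrib of_int_sum)
  finally have closed: "dedekind_sum h k = of_int h / (of_int k)\<^sup>2 * of_int (\<Sum>m\<in>{0..<k}. m\<^sup>2)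
      - of_int (\<Sum>m\<in>{0..<k}. m * (h * m div k)) / of_int k - of_int (\<Sum>m\<in>{0..<k}. m) / (2 * of_int k)" .
  \<comment> \<open>The grouping exposes \<open>6 * X\<close> and \<open>2 * Z\<close>, the left
    sides of \<open>s2\<close> and \<open>s1\<close>.\<close>
  have "12 * (H / K\<^sup>2 * X - Y / K - Z / (2 * K)) * K = 2 * (H / K) * (6 * X) - 12 * Y - 3 * (2 * Z)"
    if "K > 0" for H K X Y Z :: real
    using that by (simp add: field_simps power2_eq_square)
  then have "normalized_dedekind_sum h k * of_int k =
      2 * (of_int h / of_int k) * (6 * real_of_int (\<Sum>m\<in>{0..<k}. m\<^sup>2))
      - 12 * of_int (\<Sum>m\<in>{0..<k}. m * (h * m div k)) - 3 * (2 * real_of_int (\<Sum>m\<in>{0..<k}. m))"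
    using k unfolding normalized_dedekind_sum_def closed by simp
  then show ?thesis unfolding s1 s2 using k by simp
qed

text \<open>Multiplied by \<open>h * k\<close>, the left side contains only the unknowns
  \<open>h * F\<close> and \<open>k * F'\<close>. The squared remainders relate \<open>F\<close> to
  \<open>Q\<close>, the lattice count relates \<open>F'\<close> to \<open>Q\<close> and
  \<open>G\<close>, and \<open>G\<close> is explicit; eliminating \<open>Q\<close> evaluates the
  combination.\<close>

theorem dedekind_reciprocity:
  fixes h k :: int
  assumes h: "h > 0" and k: "k > 0" and hk: "coprime h k"
  shows "normalized_dedekind_sum h k + normalized_dedekind_sum k h =
    (of_int (h\<^sup>2) + of_int (k\<^sup>2) + 1) / (of_int h * of_int k) - 3"
proof -
  define F where "F = (\<Sum>m\<in>{0..<k}. m * (h * m div k))"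
  define F' where "F' = (\<Sum>v\<in>{0..<h}. v * (k * v div h))"
  define G where "G = (\<Sum>m\<in>{0..<k}. h * m div k)"
  define Q where "Q = (\<Sum>m\<in>{0..<k}. (h * m div k)\<^sup>2)"
  have G: "2 * G = (h - 1) * (k - 1)"
    unfolding G_def by (rule sum_floor[OF k hk])
  have "6 * (2 * h * k * F) = (h\<^sup>2 - 1) * (6 * (\<Sum>m\<in>{0..<k}. m\<^sup>2)) + 6 * (k\<^sup>2 * Q)"
    using sum_floor_squares[OF k hk, folded F_def Q_def] by (simp add: algebra_simps)
  then have Q: "6 * (2 * h * k * F) = (h\<^sup>2 - 1) * (k * (k - 1) * (2 * k - 1)) + 6 * (k\<^sup>2 * Q)"
    using k by (simp only: sum_int_squares_lessThan)
  have "Q + G = (k - 1) * (2 * (\<Sum>v\<in>{0..<h}. v)) - 2 * F'"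
    using sum_floor_double_count[OF h k hk, folded Q_def G_def F'_def] by (simp add: algebra_simps)
  then have QG: "Q + G = (k - 1) * (h * (h - 1)) - 2 * F'"
    using h by (simp only: sum_int_lessThan)
  \<comment> \<open>\<open>Q\<close> enters the first relation with coefficient
    \<open>6 * k\<^sup>2\<close>, so \<open>QG\<close> is scaled by \<open>6 * k\<^sup>2\<close> to
    cancel it. The common factor \<open>k\<close> is removed afterwards.\<close>
  have "k * (12 * h * F + 12 * k * F') = k * ((h\<^sup>2 - 1) * (k - 1) * (2 * k - 1)
      + 6 * k * (k - 1) * h * (h - 1) - 3 * k * (h - 1) * (k - 1))"
  proof -
    have "k * (12 * h * F + 12 * k * F') = 6 * (2 * h * k * F) + 6 * k\<^sup>2 * (2 * F')"
      by (simp add: power2_eq_square algebra_simps)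
    also have "2 * F' = (k - 1) * (h * (h - 1)) - Q - G" using QG by simp
    also have "6 * k\<^sup>2 * ((k - 1) * (h * (h - 1)) - Q - G) = 6 * k\<^sup>2 * ((k - 1) * (h * (h - 1)) - Q) - 3 * k\<^sup>2 * (2 * G)"
      by (simp add: algebra_simps)
    finally show ?thesis unfolding G Q by (simp add: power2_eq_square algebra_simps)
  qed
  then have "12 * h * F + 12 * k * F' = (h\<^sup>2 - 1) * (k - 1) * (2 * k - 1)
      + 6 * k * (k - 1) * h * (h - 1) - 3 * k * (h - 1) * (k - 1)"
    using k by simp
  from arg_cong[OF this, of real_of_int]
  have F: "12 * real_of_int h * of_int F + 12 * of_int k * of_int F' =
      ((of_int h)\<^sup>2 - 1) * (of_int k - 1) * (2 * of_int k - 1)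
      + 6 * of_int k * (of_int k - 1) * of_int h * (of_int h - 1)
      - 3 * of_int k * (of_int h - 1) * (of_int k - 1)"
    by simp
  have "(normalized_dedekind_sum h k + normalized_dedekind_sum k h) * (of_int h * of_int k) =
      of_int h * (normalized_dedekind_sum h k * of_int k) + of_int k * (normalized_dedekind_sum k h * of_int h)"
    by (simp add: algebra_simps)
  also have "\<dots> = of_int (h\<^sup>2) + of_int (k\<^sup>2) + 1 - 3 * (of_int h * of_int k)"
    unfolding normalized_dedekind_sum_floor[OF k hk]
      normalized_dedekind_sum_floor[OF h hk[THEN coprime_commute[THEN iffD1]]] F_def[symmetric] F'_def[symmetric]
    using F by (simp add: algebra_simps power2_eq_square)
  finally show ?thesis using h k by (simp add: field_simps)
qed

section \<open>The three-term relation\<close>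

text \<open>The fractions \<open>a / b\<close> and \<open>c / d\<close> are moved simultaneously by translations and by
  \<open>x \<mapsto> - 1 / x\<close>; neither the determinant \<open>q\<close> nor \<open>a j - b k\<close> changes.\<close>

theorem dedekind_three_term:
  fixes a b c d j k q :: int
  assumes "b > 0" "d > 0" "coprime a b" "q = a * d - b * c" "q > 0" "d * k - c * j = 1"
  shows "normalized_dedekind_sum a b - normalized_dedekind_sum c d =
    normalized_dedekind_sum (a * j - b * k) q
    + (of_int (b\<^sup>2) + of_int (d\<^sup>2) + of_int (q\<^sup>2)) / (of_int b * of_int d * of_int q) - 3"
  using assms
proof (induction "nat d" arbitrary: a b c d j k rule: less_induct)
  case less
  \<comment> \<open>Translation by \<open>m\<close> moves \<open>c / d\<close> into the interval
    from 0 to 1; \<open>k'\<close> is adjusted to preserve the Bezout relation.\<close>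
  define m where "m = c div d"
  define a' where "a' = a - m * b"
  define c' where "c' = c mod d"
  define k' where "k' = k - m * j"
  have c': "c' = c - m * d" by (simp add: c'_def m_def minus_div_mult_eq_mod)
  have cop: "coprime a' b"
  proof (rule coprimeI)
    fix e assume "e dvd a'" "e dvd b"
    then have "e dvd a' + m * b" by simp
    then have "e dvd a" by (simp add: a'_def)
    with \<open>e dvd b\<close> \<open>coprime a b\<close> show "is_unit e" using coprime_common_divisor by blast
  qed
  have det: "q = a' * d - b * c'" using less.prems by (simp add: a'_def c' algebra_simps)
  have jk: "d * k' - c' * j = 1" using less.prems by (simp add: k'_def c' algebra_simps)
  have r: "a * j - b * k = a' * j - b * k'" by (simp add: a'_def k'_def algebra_simps)
  have S: "normalized_dedekind_sum a b = normalized_dedekind_sum a' b"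
      "normalized_dedekind_sum c d = normalized_dedekind_sum c' d"
    using less.prems
    by (auto intro!: normalized_dedekind_sum_cong simp: a'_def c' cong_iff_dvd_diff)
  have c'_bounds: "0 \<le> c'" "c' < d" using less.prems by (auto simp: c'_def)
  \<comment> \<open>Here \<open>a' * d = q + b * c'\<close>; positivity of \<open>a'\<close> makes
    it a legitimate modulus after inversion.\<close>
  have "a' * d > 0" using det \<open>q > 0\<close> \<open>b > 0\<close> c'_bounds by (smt (verit) mult_nonneg_nonneg)
  then have "a' > 0" using \<open>d > 0\<close> by (simp add: zero_less_mult_iff)
  have recip_ab: "normalized_dedekind_sum a' b = normalized_dedekind_sum (- b) a'
      + (of_int (a'\<^sup>2) + of_int (b\<^sup>2) + 1) / (of_int a' * of_int b) - 3"
    using dedekind_reciprocity[OF \<open>a' > 0\<close> \<open>b > 0\<close> cop] by (simp add: normalized_dedekind_sum_minus)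
  show ?case
  proof (cases "c' = 0")
    case True
    \<comment> \<open>End of the Euclidean algorithm: \<open>d * k' = 1\<close>, the sum for
      \<open>c' / d\<close> vanishes, and the claim is the reciprocity law for \<open>a'\<close> and
      \<open>b\<close>, up to a shift by \<open>a' * j\<close> modulo \<open>q = a'\<close>.\<close>
    with jk \<open>d > 0\<close> have "d = 1" "k' = 1" by (auto simp: zmult_eq_1_iff)
    with True det have "q = a'" by simp
    have "normalized_dedekind_sum (a' * j - b) a' = normalized_dedekind_sum (- b) a'"
      using \<open>a' > 0\<close> by (auto intro!: normalized_dedekind_sum_cong simp: cong_iff_dvd_diff)
    moreover have "normalized_dedekind_sum 0 1 = 0"
      by (simp add: normalized_dedekind_sum_def dedekind_sum_def sawtooth_def)
    ultimately show ?thesis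
      unfolding S r recip_ab unfolding \<open>d = 1\<close> \<open>k' = 1\<close> \<open>q = a'\<close> True by (simp add: algebra_simps)
  next
    case False
    with c'_bounds have "c' > 0" by simp
    have "coprime c' d"
    proof (rule coprimeI)
      fix e assume "e dvd c'" "e dvd d"
      then have "e dvd d * k' - c' * j" by simp
      then show "is_unit e" by (simp only: jk)
    qed
    then have recip_cd: "normalized_dedekind_sum c' d = normalized_dedekind_sum (- d) c'
      + (of_int (c'\<^sup>2) + of_int (d\<^sup>2) + 1) / (of_int c' * of_int d) - 3"
      using dedekind_reciprocity[OF \<open>c' > 0\<close> \<open>d > 0\<close>] by (simp add: normalized_dedekind_sum_minus)
    \<comment> \<open>Induction applies to \<open>- b / a'\<close> and \<open>- d / c'\<close>, as
      \<open>c' < d\<close>. The Bezout pair \<open>j\<close>, \<open>k\<close> becomes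
      \<open>k'\<close>, \<open>- j\<close>, and the determinant is still \<open>q\<close>.\<close>
    have "normalized_dedekind_sum (- b) a' - normalized_dedekind_sum (- d) c' =
      normalized_dedekind_sum (- b * k' - a' * (- j)) q
      + (of_int (a'\<^sup>2) + of_int (c'\<^sup>2) + of_int (q\<^sup>2)) / (of_int a' * of_int c' * of_int q) - 3"
      using c'_bounds \<open>c' > 0\<close> \<open>a' > 0\<close> \<open>d > 0\<close> cop det jk \<open>q > 0\<close>
      by (intro less.hyps) (auto simp: coprime_commute algebra_simps)
    moreover have "- b * k' - a' * (- j) = a' * j - b * k'" by simp
    ultimately have IH: "normalized_dedekind_sum (- b) a' - normalized_dedekind_sum (- d) c' =
      normalized_dedekind_sum (a' * j - b * k') q
      + (of_int (a'\<^sup>2) + of_int (c'\<^sup>2) + of_int (q\<^sup>2)) / (of_int a' * of_int c' * of_int q) - 3"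
      by simp
    define A B C D R where "A = real_of_int a'" "B = real_of_int b" "C = real_of_int c'"
      "D = real_of_int d" "R = real_of_int q"
    have nz: "A > 0" "B > 0" "C > 0" "D > 0" "R > 0"
      using \<open>a' > 0\<close> \<open>b > 0\<close> \<open>c' > 0\<close> \<open>d > 0\<close> \<open>q > 0\<close> by (simp_all add: A_B_C_D_R_def)
    have R: "R = A * D - B * C" by (simp add: A_B_C_D_R_def det)
    \<comment> \<open>The rational terms of the induction hypothesis and of the two reciprocity laws
      add up to the required one; the constants \<open>- 3\<close> of the two laws cancel each
      other.\<close>
    have id: "(A\<^sup>2 + C\<^sup>2 + R\<^sup>2) / (A * C * R) + (A\<^sup>2 + B\<^sup>2 + 1) / (A * B) - (C\<^sup>2 + D\<^sup>2 + 1) / (C * D)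
      = (B\<^sup>2 + D\<^sup>2 + R\<^sup>2) / (B * D * R)"
    proof -
      have "(A\<^sup>2 + C\<^sup>2 + R\<^sup>2) * (B * D) + (A\<^sup>2 + B\<^sup>2 + 1) * (C * D * R) - (C\<^sup>2 + D\<^sup>2 + 1) * (A * B * R)
        = (B\<^sup>2 + D\<^sup>2 + R\<^sup>2) * (A * C)"
        unfolding R by (simp add: power2_eq_square algebra_simps)
      moreover have "(A\<^sup>2 + C\<^sup>2 + R\<^sup>2) / (A * C * R) = (A\<^sup>2 + C\<^sup>2 + R\<^sup>2) * (B * D) / (A * B * C * D * R)"
        "(A\<^sup>2 + B\<^sup>2 + 1) / (A * B) = (A\<^sup>2 + B\<^sup>2 + 1) * (C * D * R) / (A * B * C * D * R)"
        "(C\<^sup>2 + D\<^sup>2 + 1) / (C * D) = (C\<^sup>2 + D\<^sup>2 + 1) * (A * B * R) / (A * B * C * D * R)"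
        "(B\<^sup>2 + D\<^sup>2 + R\<^sup>2) / (B * D * R) = (B\<^sup>2 + D\<^sup>2 + R\<^sup>2) * (A * C) / (A * B * C * D * R)"
        using nz by simp_all
      ultimately show ?thesis by (simp only: add_divide_distrib[symmetric] diff_divide_distrib[symmetric])
    qed
    show ?thesis
      unfolding S r recip_ab recip_cd using IH id unfolding A_B_C_D_R_def 
      by simp
  qed
qed

section \<open>Equality of two Dedekind sums with the same modulus\<close>

theorem theorem1:
  fixes b c d t :: int
  assumes "b > 0"
    and "gcd c b = 1" and "gcd d b = 1"
    and "\<not> [c = d] (mod b)"
    and "[(c - d) * (c * d - 1) = 0] (mod b)"
    and "t > 0" and "[t = c - d] (mod b)"
  shows "normalized_dedekind_sum c b = normalized_dedekind_sum d b \<longleftrightarrow>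
    normalized_dedekind_sum (1 + c * t) (b * t) = (2 + of_int (t\<^sup>2)) / of_int (b * t) - 3"
proof -
  note b = \<open>b > 0\<close>
  obtain e where e: "[c * e = 1] (mod b)"
    using \<open>gcd c b = 1\<close> by (metis cong_solve_coprime_int coprime_iff_gcd_eq_1)
  then obtain k where k: "b * k = 1 - c * e"
    by (metis cong_iff_dvd_diff cong_sym dvdE)
  have ed: "[(e + t) * d = 1] (mod b)"
  proof -
    have "[(e + t) * d = (e + (c - d)) * d] (mod b)"
      using \<open>[t = c - d] (mod b)\<close> by (intro cong_mult cong_add cong_refl)
    moreover have "[(e + (c - d)) * d = 1] (mod b)"
    proof -
      obtain l where l: "(c - d) * (c * d - 1) = b * l"
        using assms(5) by (auto simp: cong_0_iff)
      \<comment> \<open>Obtained by multiplying the equation \<open>l\<close> by \<open>e\<close>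
        and replacing \<open>c * e\<close> by \<open>1 - b * k\<close>.\<close>
      have "(e + (c - d)) * d - 1 = b * (e * l + k * (c - d) * d - k)"
        using k l by algebra
      then show ?thesis by (simp add: cong_iff_dvd_diff)
    qed
    ultimately show ?thesis by (rule cong_trans)
  qed
  then have "coprime (e + t) b" by (metis coprime_iff_invertible_int)
  \<comment> \<open>The fractions \<open>(e + t) / b\<close> and \<open>e / b\<close> have
    determinant \<open>b * t\<close>, and \<open>b * k - e * (- c) = 1\<close> supplies the Bezout
    pair \<open>- c\<close>, \<open>k\<close>.\<close>
  then have "normalized_dedekind_sum (e + t) b - normalized_dedekind_sum e b =
      normalized_dedekind_sum ((e + t) * (- c) - b * k) (b * t)
      + (of_int (b\<^sup>2) + of_int (b\<^sup>2) + of_int ((b * t)\<^sup>2)) / (of_int b * of_int b * of_int (b * t)) - 3"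
    using b \<open>t > 0\<close> k by (intro dedekind_three_term) (auto simp: algebra_simps)
  moreover have "(e + t) * (- c) - b * k = - (1 + c * t)"
    using k by (simp add: algebra_simps)
  moreover have "(of_int (b\<^sup>2) + of_int (b\<^sup>2) + of_int ((b * t)\<^sup>2)) / (of_int b * of_int b * of_int (b * t))
      = (2 + of_int (t\<^sup>2)) / real_of_int (b * t)"
    using b \<open>t > 0\<close> by (simp add: divide_simps) (simp add: power2_eq_square algebra_simps)
  moreover have "normalized_dedekind_sum (e + t) b = normalized_dedekind_sum d b"
    using b ed by (rule normalized_dedekind_sum_inverse)
  moreover have "normalized_dedekind_sum c b = normalized_dedekind_sum e b"
    using b e by (rule normalized_dedekind_sum_inverse)
  ultimately show ?thesis
    by (simp only: normalized_dedekind_sum_minus) linarith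
qed

end
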